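(* Let $n\geq 3$. Let $X_1,\ldots,X_n,Y_1,\ldots,Y_n$ be independent real random variables such that $X_1,\ldots,X_n$ are identically distributed with $E(X_i^2)<\infty$, $Y_1,\ldots,Y_n$ are identically distributed with $E(Y_i^2)<\infty$, and $E(X_i)=E(Y_i)=0$. Assume that the characteristic functions $f_1(t)=E(e^{itX_i})$ and $f_2(t)=E(e^{itY_i})$ do not vanish for any real $t$. Put $\bar X=(X_1+\cdots+X_n)/n$ and $\bar Y=(Y_1+\cdots+Y_n)/n$. Then the relation \[ E\{\bar X\mid X_1-\bar X+Y_1-\bar Y,\ldots,X_n-\bar X+Y_n-\bar Y\}=E\{\bar Y\mid X_1-\bar X+Y_1-\bar Y,\ldots,X_n-\bar X+Y_n-\bar Y\}\quad\text{(almost surely)} \] holds if and only if one of the following holds: (i) $X_i$ and $Y_i$ have the same (arbitrary) distribution; (ii) $X_i\cong Y_i+\xi$, where $\xi$ is a Gaussian random variable independent of $Y_i$ (and the distribution of $Y_i$ is otherwise arbitrary); (iii) $Y_i\cong X_i+\eta$, where $\eta$ is a Gaussian random variable independent of $X_i$ (and the distribution of $X_i$ is otherwise arbitrary). In other words, under this relation, unless $X_i$ and $Y_i$ are identically distributed, at least one of them has a Gaussian component.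
   Context: $U\cong V$ means that the random variables $U$ and $V$ have the same distribution. A random variable $X$ is said to have a Gaussian component if $X\cong U+\xi$, where $U$ and $\xi$ are independent and $\xi$ is non-degenerate Gaussian (normal with positive variance). The Gaussian variables $\xi,\eta$ in (ii) and (iii) are non-degenerate; conditions (ii) and (iii) are conditions on distributions, so $\xi$ and $\eta$ may be taken on an enlarged probability space. Conditional expectations are with respect to the $\sigma$-algebra generated by the $n$ listed random variables. *)

theory Defs
  imports "HOL-Probability.Probability"
begin

definition gen_sigma :: "'a measure \<Rightarrow> 'i set \<Rightarrow> ('i \<Rightarrow> 'a \<Rightarrow> real) \<Rightarrow> 'a measure" where
  "gen_sigma M I W =
     sigma (space M) {W i -` A \<inter> space M | i A. i \<in> I \<and> A \<in> sets borel}"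

definition sample_mean :: "nat \<Rightarrow> (nat \<Rightarrow> 'a \<Rightarrow> real) \<Rightarrow> 'a \<Rightarrow> real" where
  "sample_mean n X \<omega> = (\<Sum>i=1..n. X i \<omega>) / real n"

definition gaussian_rv :: "'a measure \<Rightarrow> ('a \<Rightarrow> real) \<Rightarrow> bool" where
  "gaussian_rv N \<xi> \<longleftrightarrow> (\<exists>m \<sigma>. 0 < \<sigma> \<and> distributed N lborel \<xi> (normal_density m \<sigma>))"

text \<open>
  The next two predicates depend only on the distributions of the random variables.  The auxiliary
  probability space may be taken on the fixed type \<^typ>\<open>real \<times> real\<close> without loss of generality:
  any pair of real random variables can be replaced by the two coordinates of the plane under
  its joint distribution.
\<close>

definition eq_distr_plus_gaussian :: "'a measure \<Rightarrow> ('a \<Rightarrow> real) \<Rightarrow> ('a \<Rightarrow> real) \<Rightarrow> bool" where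
  "eq_distr_plus_gaussian M X Y \<longleftrightarrow>
     (\<exists>(N :: (real \<times> real) measure) U \<xi>.
        prob_space N \<and> prob_space.indep_var N borel U borel \<xi> \<and> gaussian_rv N \<xi> \<and>
        distr N borel U = distr M borel Y \<and>
        distr M borel X = distr N borel (\<lambda>\<omega>. U \<omega> + \<xi> \<omega>))"

definition has_gaussian_component :: "'a measure \<Rightarrow> ('a \<Rightarrow> real) \<Rightarrow> bool" where
  "has_gaussian_component M X \<longleftrightarrow>
     (\<exists>(N :: (real \<times> real) measure) U \<xi>.
        prob_space N \<and> prob_space.indep_var N borel U borel \<xi> \<and> gaussian_rv N \<xi> \<and>
        distr M borel X = distr N borel (\<lambda>\<omega>. U \<omega> + \<xi> \<omega>))"

end

theory Submission imports Defs begin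

text \<open>
  Testing the relation against the characters of the residuals turns it, by uniqueness of Fourier
  transforms of signed measures, into
  \<open>E ((mean X - mean Y) * exp (i (\<Sum>k. u k * (X k + Y k)))) = 0\<close> for all \<open>u\<close> with \<open>(\<Sum>k. u k) = 0\<close>.
  By independence and since the characteristic functions do not vanish, this says
  \<open>(\<Sum>k. \<phi> (u k)) = 0\<close> for such \<open>u\<close>, where \<open>\<phi>\<close> is the difference of the logarithmic derivatives
  of \<open>f1\<close> and \<open>f2\<close> up to the factor \<open>i\<close>.  As \<open>n \<ge> 3\<close>, the continuous function \<open>\<phi>\<close> is additive,
  hence linear, so \<open>f1 u / f2 u = exp (- s * u\<^sup>2 / 2)\<close>; here \<open>s\<close> is real because \<open>\<phi> (- u)\<close> is
  the conjugate of \<open>\<phi> u\<close>.  The sign of \<open>s\<close> distinguishes the three cases.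
\<close>

subsection \<open>Uniqueness of Fourier transforms of signed measures\<close>

text \<open>A nonnegative weight \<open>V\<close> of total mass 1 is a probability density on
  \<open>M\<close>. Its image under \<open>W\<close> is a distribution on the line, whose
  characteristic function and probabilities are the weighted integrals. This makes Levy's uniqueness
  theorem available for weighted integrals.\<close>

lemma char_density_distr:
  fixes V W :: "'a \<Rightarrow> real"
  assumes V: "integrable M V" "\<And>x. 0 \<le> V x" and mass: "(\<integral>x. V x \<partial>M) = 1"
    and [measurable]: "W \<in> borel_measurable M"
  shows "real_distribution (distr (density M V) borel W)"
    and "char (distr (density M V) borel W) t = (CLINT x|M. V x * iexp (t * W x))"
    and "B \<in> sets borel \<Longrightarrow> measure (distr (density M V) borel W) B = (\<integral>x. V x * indicator B (W x) \<partial>M)"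
proof -
  have [measurable]: "V \<in> borel_measurable M"
    using V(1) by simp
  have "emeasure (density M V) (space M) = 1"
    using V mass by (simp add: emeasure_density nn_integral_eq_integral cong: nn_integral_cong)
  then interpret D: prob_space "density M V"
    by (intro prob_spaceI) simp
  show "real_distribution (distr (density M V) borel W)"
    by (intro D.real_distribution_distr) simp
  show "char (distr (density M V) borel W) t = (CLINT x|M. V x * iexp (t * W x))"
    unfolding char_def using V
    by (subst integral_distr) (auto simp: integral_density scaleR_conv_of_real)
  assume [measurable]: "B \<in> sets borel"
  have "measure (distr (density M V) borel W) B = (\<integral>x. indicator B x \<partial>distr (density M V) borel W)"
    by simp
  also have "\<dots> = (\<integral>x. V x * indicator B (W x) \<partial>M)"
    using V by (subst integral_distr) (auto simp: integral_density)
  finally show "measure (distr (density M V) borel W) B = (\<integral>x. V x * indicator B (W x) \<partial>M)" .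
qed

text \<open>Division by the common mass turns both weights into probability densities, and Levy's
  theorem identifies the image distributions.\<close>

lemma weighted_char_uniqueness_nonneg:
  fixes U V W :: "'a \<Rightarrow> real"
  assumes U: "integrable M U" "\<And>x. 0 \<le> U x" and V: "integrable M V" "\<And>x. 0 \<le> V x"
    and W: "W \<in> borel_measurable M" and B: "B \<in> sets borel"
    and eq: "\<And>t. (CLINT x|M. U x * iexp (t * W x)) = (CLINT x|M. V x * iexp (t * W x))"
  shows "(\<integral>x. U x * indicator B (W x) \<partial>M) = (\<integral>x. V x * indicator B (W x) \<partial>M)"
proof -
  define c where "c = (\<integral>x. U x \<partial>M)"
  \<comment> \<open>Frequency 0 shows that both weights have the same mass.\<close>
  have c: "c = (\<integral>x. V x \<partial>M)"
    using eq[of 0] by (simp add: c_def)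
  show ?thesis
  \<comment> \<open>Mass 0 cannot be normalised, but then both weights vanish almost
    everywhere.\<close>
  proof (cases "c = 0")
    case True
    have "AE x in M. U x = 0"
      using U True by (simp add: c_def integral_nonneg_eq_0_iff_AE)
    moreover have "AE x in M. V x = 0"
      using V True by (simp add: c integral_nonneg_eq_0_iff_AE)
    ultimately
    have "AE x in M. U x * indicator B (W x) = 0" "AE x in M. V x * indicator B (W x) = 0"
      by auto
    then show ?thesis
      by (simp add: integral_eq_zero_AE)
  next
    case False
    moreover have "0 \<le> c"
      using U by (simp add: c_def)
    ultimately have "0 < c" by simp
    have U': "integrable M (\<lambda>x. U x / c)" "\<And>x. 0 \<le> U x / c" "(\<integral>x. U x / c \<partial>M) = 1"
      using U \<open>0 < c\<close> by (auto simp: c_def)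
    have V': "integrable M (\<lambda>x. V x / c)" "\<And>x. 0 \<le> V x / c" "(\<integral>x. V x / c \<partial>M) = 1"
      using V \<open>0 < c\<close> by (auto simp: c)
    have "distr (density M (\<lambda>x. U x / c)) borel W = distr (density M (\<lambda>x. V x / c)) borel W"
    proof (rule Levy_uniqueness)
      show "char (distr (density M (\<lambda>x. U x / c)) borel W) = char (distr (density M (\<lambda>x. V x / c)) borel W)"
        unfolding char_density_distr(2)[OF U' W] char_density_distr(2)[OF V' W]
        using eq by (simp add: fun_eq_iff)
    qed (rule char_density_distr(1)[OF U' W] char_density_distr(1)[OF V' W])+
    then have "(\<integral>x. U x / c * indicator B (W x) \<partial>M) = (\<integral>x. V x / c * indicator B (W x) \<partial>M)"
      using char_density_distr(3)[OF U' W B] char_density_distr(3)[OF V' W B] by (simp only:)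
    then show ?thesis
      using \<open>0 < c\<close> by simp
  qed
qed

lemma integrable_mult_bounded:
  fixes V f :: "'a \<Rightarrow> 'b::{real_normed_algebra, banach, second_countable_topology}"
  assumes V: "integrable M V" and f: "f \<in> borel_measurable M" "\<And>x. norm (f x) \<le> 1"
  shows "integrable M (\<lambda>x. V x * f x)"
proof (rule Bochner_Integration.integrable_bound[OF V])
  show "(\<lambda>x. V x * f x) \<in> borel_measurable M"
    using V f by (auto intro: borel_measurable_times)
  have "norm (V x * f x) \<le> norm (V x)" for x
    by (rule order_trans[OF norm_mult_ineq]) (simp add: f mult_left_le)
  then show "AE x in M. norm (V x * f x) \<le> norm (V x)" by simp
qed

text \<open>A vanishing transform says that the positive and negative parts of \<open>V\<close> have
  equal transforms, which reduces the claim to nonnegative weights.\<close>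

lemma weighted_char_uniqueness_real:
  fixes V W :: "'a \<Rightarrow> real"
  assumes V: "integrable M V" and W[measurable]: "W \<in> borel_measurable M" and B: "B \<in> sets borel"
    and zero: "\<And>t. (CLINT x|M. V x * iexp (t * W x)) = 0"
  shows "(\<integral>x. V x * indicator B (W x) \<partial>M) = 0"
proof -
  let ?P = "\<lambda>x. max 0 (V x)" and ?N = "\<lambda>x. max 0 (- V x)"
  have split: "V x = ?P x - ?N x" for x by auto
  have P: "integrable M ?P" and N: "integrable M ?N"
    using V by auto
  have ind: "(\<lambda>x. indicator B (W x) :: real) \<in> borel_measurable M"
    using B by measurable
  have "(\<integral>x. ?P x * indicator B (W x) \<partial>M) = (\<integral>x. ?N x * indicator B (W x) \<partial>M)"
  proof (rule weighted_char_uniqueness_nonneg[OF P _ N _ W B])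
    fix t
    have "integrable M (\<lambda>x. complex_of_real (?P x) * iexp (t * W x))"
         "integrable M (\<lambda>x. complex_of_real (?N x) * iexp (t * W x))"
      using P N by (auto intro!: integrable_mult_bounded)
    then have "(CLINT x|M. ?P x * iexp (t * W x)) - (CLINT x|M. ?N x * iexp (t * W x))
        = (CLINT x|M. V x * iexp (t * W x))"
      by (subst Bochner_Integration.integral_diff[symmetric])
         (auto simp: left_diff_distrib[symmetric] of_real_diff[symmetric] split[symmetric]
           simp del: of_real_diff)
    then show "(CLINT x|M. ?P x * iexp (t * W x)) = (CLINT x|M. ?N x * iexp (t * W x))"
      using zero[of t] by simp
  qed auto
  moreover have "(\<integral>x. V x * indicator B (W x) \<partial>M)
      = (\<integral>x. ?P x * indicator B (W x) \<partial>M) - (\<integral>x. ?N x * indicator B (W x) \<partial>M)"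
    using P N ind
    by (subst Bochner_Integration.integral_diff[symmetric])
       (auto simp: left_diff_distrib[symmetric] split[symmetric] intro!: integrable_mult_bounded)
  ultimately show ?thesis by simp
qed

text \<open>The conjugate weight also has vanishing transform, hence so have the real and imaginary
  parts of \<open>V\<close>, as linear combinations of \<open>V\<close> and \<open>cnj V\<close>.
  Complex weights are needed for the induction over several variables, where characters are absorbed
  into the weight.\<close>

lemma weighted_char_uniqueness:
  fixes V :: "'a \<Rightarrow> complex" and W :: "'a \<Rightarrow> real"
  assumes V: "integrable M V" and W[measurable]: "W \<in> borel_measurable M" and B: "B \<in> sets borel"
    and zero: "\<And>t. (CLINT x|M. V x * iexp (t * W x)) = 0"
  shows "(CLINT x|M. V x * indicator B (W x)) = 0"
proof -
  have int: "integrable M (\<lambda>x. V x * iexp (t * W x))" for t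
    using V by (auto intro!: integrable_mult_bounded)
  have int_cnj: "integrable M (\<lambda>x. cnj (V x) * iexp (t * W x))" for t
    using V by (auto intro!: integrable_mult_bounded)
  \<comment> \<open>Conjugation reverses the frequency, so the hypothesis is used at
    \<open>- t\<close>.\<close>
  have zero_cnj: "(CLINT x|M. cnj (V x) * iexp (t * W x)) = 0" for t
  proof -
    have "(CLINT x|M. cnj (V x) * iexp (t * W x)) = (CLINT x|M. cnj (V x * iexp (- t * W x)))"
      by (simp add: exp_cnj)
    also have "\<dots> = 0"
      by (subst Bochner_Integration.integral_cnj) (metis zero complex_cnj_zero)
    finally show ?thesis .
  qed
  have Re0: "(CLINT x|M. Re (V x) * iexp (t * W x)) = 0" for t
  proof -
    have "(CLINT x|M. Re (V x) * iexp (t * W x))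
        = (CLINT x|M. (1/2) * (V x * iexp (t * W x) + cnj (V x) * iexp (t * W x)))"
      by (simp add: distrib_right[symmetric] complex_add_cnj)
    also have "\<dots> = 0"
      using int int_cnj zero zero_cnj
      by (subst integral_mult_right_zero) simp
    finally show ?thesis .
  qed
  have Im0: "(CLINT x|M. Im (V x) * iexp (t * W x)) = 0" for t
  proof -
    have "(CLINT x|M. Im (V x) * iexp (t * W x))
        = (CLINT x|M. (-\<i>/2) * (V x * iexp (t * W x) - cnj (V x) * iexp (t * W x)))"
      by (intro Bochner_Integration.integral_cong) (auto simp: complex_eq_iff field_simps)
    also have "\<dots> = 0"
      using int int_cnj zero zero_cnj
      by (subst integral_mult_right_zero) simp
    finally show ?thesis .
  qed
  have "integrable M (\<lambda>x. V x * indicator B (W x))"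
    using V B by (intro integrable_mult_bounded) (auto simp: indicator_def)
  then have "Re (CLINT x|M. V x * indicator B (W x)) = (\<integral>x. Re (V x) * indicator B (W x) \<partial>M)"
    and "Im (CLINT x|M. V x * indicator B (W x)) = (\<integral>x. Im (V x) * indicator B (W x) \<partial>M)"
    by (auto simp: integral_Re[symmetric] integral_Im[symmetric] indicator_def
        intro!: Bochner_Integration.integral_cong simp del: integral_Re integral_Im)
  then show ?thesis
    using weighted_char_uniqueness_real[OF integrable_Re[OF V] W B Re0]
          weighted_char_uniqueness_real[OF integrable_Im[OF V] W B Im0]
    by (simp add: complex_eq_iff)
qed

text \<open>Characters are exchanged for indicators one coordinate at a time. The weight is
  arbitrary in the induction because it has to absorb the factor of the new coordinate.\<close>

lemma weighted_char_uniqueness_finite: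
  fixes V :: "'a \<Rightarrow> complex" and W :: "'i \<Rightarrow> 'a \<Rightarrow> real"
  assumes "finite I" "integrable M V" "\<And>i. i \<in> I \<Longrightarrow> W i \<in> borel_measurable M"
    and "\<And>i. i \<in> I \<Longrightarrow> B i \<in> sets borel"
    and "\<And>t. (CLINT x|M. V x * (\<Prod>i\<in>I. iexp (t i * W i x))) = 0"
  shows "(CLINT x|M. V x * (\<Prod>i\<in>I. indicator (B i) (W i x))) = 0"
  using assms
proof (induction I arbitrary: V rule: finite_induct)
  case empty
  then show ?case by simp
next
  case (insert i I)
  note [measurable] = insert.prems(2)[OF insertI1] insert.prems(2)[OF insertI2]
    insert.prems(3)[OF insertI1] insert.prems(3)[OF insertI2]
  have ind: "(\<lambda>x. \<Prod>j\<in>I. indicator (B j) (W j x) :: complex) \<in> borel_measurable M"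
    by measurable
  \<comment> \<open>The indicators of the old coordinates are now part of the weight, and the
    one-variable result treats coordinate \<open>i\<close>.\<close>
  have "(CLINT x|M. (V x * (\<Prod>j\<in>I. indicator (B j) (W j x))) * indicator (B i) (W i x)) = 0"
  proof (rule weighted_char_uniqueness)
    show "integrable M (\<lambda>x. V x * (\<Prod>j\<in>I. indicator (B j) (W j x)))"
      using insert.prems(1) ind
      by (intro integrable_mult_bounded) (auto simp: prod_norm[symmetric] intro!: prod_le_1 split: split_indicator)
    fix t
    \<comment> \<open>Here the character of the new coordinate, at a fixed frequency
      \<open>t\<close>, is part of the weight to which the induction hypothesis is applied.\<close>
    have "(CLINT x|M. (V x * iexp (t * W i x)) * (\<Prod>j\<in>I. indicator (B j) (W j x))) = 0"
    proof (rule insert.IH)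
      show "integrable M (\<lambda>x. V x * iexp (t * W i x))"
        using insert.prems(1) by (auto intro!: integrable_mult_bounded)
      fix s
      have "(\<Prod>j\<in>I. iexp ((s(i := t)) j * W j x)) = (\<Prod>j\<in>I. iexp (s j * W j x))" for x
        using insert.hyps by (intro prod.cong) auto
      then show "(CLINT x|M. (V x * iexp (t * W i x)) * (\<Prod>j\<in>I. iexp (s j * W j x))) = 0"
        using insert.prems(4)[of "s(i := t)"] insert.hyps by (simp add: mult.assoc)
    qed auto
    then show "(CLINT x|M. (V x * (\<Prod>j\<in>I. indicator (B j) (W j x))) * iexp (t * W i x)) = 0"
      by (simp add: mult.assoc mult.left_commute mult.commute)
  qed auto
  then show ?case
    using insert.hyps by (simp add: mult.assoc mult.left_commute mult.commute)
qed

subsection \<open>Conditional expectations given finitely many random variables\<close>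

lemma sets_gen_sigma:
  "sets (gen_sigma M I W) =
    sigma_sets (space M) {W i -` A \<inter> space M | i A. i \<in> I \<and> A \<in> sets borel}"
  and space_gen_sigma: "space (gen_sigma M I W) = space M"
  unfolding gen_sigma_def by (subst sets_measure_of space_measure_of; blast)+

lemma measurable_gen_sigma:
  assumes "i \<in> I"
  shows "W i \<in> borel_measurable (gen_sigma M I W)"
  using assms by (auto simp: measurable_def sets_gen_sigma space_gen_sigma)

lemma subalgebra_gen_sigma:
  assumes "\<And>i. i \<in> I \<Longrightarrow> W i \<in> borel_measurable M"
  shows "subalgebra M (gen_sigma M I W)"
  unfolding subalgebra_def space_gen_sigma sets_gen_sigma
  using assms by (auto intro!: sets.sigma_sets_subset measurable_sets)

text \<open>Boxes in the coordinates \<open>W i\<close> form an intersection-stable generator of the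
  sigma-algebra. The integral of \<open>V\<close> vanishes on boxes by Fourier uniqueness, and
  Dynkin's argument extends this to all sets.\<close>

lemma set_integral_gen_sigma_eq_0:
  fixes V :: "'a \<Rightarrow> real"
  assumes I: "finite I" and V: "integrable M V"
    and W: "\<And>i. i \<in> I \<Longrightarrow> W i \<in> borel_measurable M"
    and zero: "\<And>t. (CLINT x|M. V x * (\<Prod>i\<in>I. iexp (t i * W i x))) = 0"
    and A: "A \<in> sets (gen_sigma M I W)"
  shows "(\<integral>x\<in>A. V x \<partial>M) = 0"
proof -
  define G where "G = {{x \<in> space M. \<forall>i\<in>I. W i x \<in> B i} | B. \<forall>i\<in>I. B i \<in> sets borel}"
  have box: "{x \<in> space M. \<forall>i\<in>I. W i x \<in> B i} \<in> sets M" if "\<forall>i\<in>I. B i \<in> sets borel" for B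
    using W that I by (intro sets.sets_Collect_finite_All predE pred_sets2) auto
  have GM: "G \<subseteq> sets M"
    using box by (auto simp: G_def)
  have sGM: "sigma_sets (space M) G \<subseteq> sets M"
    using GM by (rule sets.sigma_sets_subset)
  have "{W i -` A \<inter> space M | i A. i \<in> I \<and> A \<in> sets borel} \<subseteq> G"
  proof safe
    fix i and B :: "real set" assume "i \<in> I" "B \<in> sets borel"
    then show "W i -` B \<inter> space M \<in> G"
      \<comment> \<open>A preimage under a single coordinate is the box whose other sides are the
        whole line.\<close>
      unfolding G_def by (intro CollectI exI[of _ "\<lambda>j. if j = i then B else UNIV"]) auto
  qed
  then have A': "A \<in> sigma_sets (space M) G"
    using A sigma_sets_mono' unfolding sets_gen_sigma by blast
  have int: "set_integrable M S V" if "S \<in> sigma_sets (space M) G" for S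
    using that sGM V unfolding set_integrable_def by (intro integrable_mult_indicator) auto
  have basic: "(\<integral>x\<in>S. V x \<partial>M) = 0" if S: "S \<in> G" for S
  proof -
    obtain B where B: "\<forall>i\<in>I. B i \<in> sets borel" and SB: "S = {x \<in> space M. \<forall>i\<in>I. W i x \<in> B i}"
      using S by (auto simp: G_def)
    \<comment> \<open>The indicator of a box is the product of the indicators of its sides.\<close>
    have "complex_of_real (\<integral>x\<in>S. V x \<partial>M) = (CLINT x|M. of_real (V x) * (\<Prod>i\<in>I. indicator (B i) (W i x)))"
      unfolding set_lebesgue_integral_def integral_complex_of_real[symmetric]
      using I by (intro Bochner_Integration.integral_cong) (auto simp: SB indicator_def prod_zero_iff)
    also have "\<dots> = 0"
      using I V W B zero by (intro weighted_char_uniqueness_finite) auto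
    finally show ?thesis by simp
  qed
  have "Int_stable G"
  proof (rule Int_stableI)
    fix S T assume "S \<in> G" "T \<in> G"
    then obtain B C where "\<forall>i\<in>I. B i \<in> sets borel" "S = {x \<in> space M. \<forall>i\<in>I. W i x \<in> B i}"
      "\<forall>i\<in>I. C i \<in> sets borel" "T = {x \<in> space M. \<forall>i\<in>I. W i x \<in> C i}"
      by (auto simp: G_def)
    then show "S \<inter> T \<in> G"
      unfolding G_def by (intro CollectI exI[of _ "\<lambda>i. B i \<inter> C i"]) auto
  qed
  moreover have "G \<subseteq> Pow (space M)"
    by (auto simp: G_def)
  ultimately show ?thesis
    using A'
  proof (induction rule: sigma_sets_induct_disjoint)
    case (basic A)
    then show ?case by (rule \<open>\<And>S. S \<in> G \<Longrightarrow> (\<integral>x\<in>S. V x \<partial>M) = 0\<close>)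
  next
    case empty
    show ?case by (simp add: set_lebesgue_integral_def)
  next
    case (compl A)
    \<comment> \<open>The whole space is itself a box, so the total integral is 0 and complements
      inherit the property.\<close>
    have "space M \<in> G"
      unfolding G_def by (intro CollectI exI[of _ "\<lambda>_. UNIV"]) auto
    then have "(\<integral>x\<in>space M. V x \<partial>M) = 0"
      by (rule basic)
    moreover have "(\<integral>x\<in>A \<union> (space M - A). V x \<partial>M) = (\<integral>x\<in>A. V x \<partial>M) + (\<integral>x\<in>space M - A. V x \<partial>M)"
      using compl by (intro set_integral_Un int) (auto intro: sigma_sets.Compl)
    moreover have "A \<union> (space M - A) = space M"
      using compl(1) sGM sets.sets_into_space by blast
    ultimately show ?case using compl by simp
  next
    case (union A)
    have "(\<integral>x\<in>(\<Union>i. A i). V x \<partial>M) = (\<Sum>i. (\<integral>x\<in>A i. V x \<partial>M))"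
    proof (rule lebesgue_integral_countable_add)
      show "A i \<in> sets M" for i
        using union(2) sGM by blast
      show "set_integrable M (\<Union>i. A i) V"
        using union(2) by (intro int sigma_sets.Union) auto
    qed (use union(1) in \<open>auto simp: disjoint_family_on_def\<close>)
    then show ?case using union by simp
  qed
qed

text \<open>By linearity the relation says that the conditional expectation of \<open>U - V\<close>
  is zero. Characters of the \<open>W i\<close> are bounded and measurable for the sigma-algebra, so
  they are then orthogonal to \<open>U - V\<close>. Conversely, orthogonality to all characters
  makes every set integral over the sigma-algebra vanish, which characterises the conditional
  expectation as zero.\<close>

lemma (in prob_space) real_cond_exp_gen_sigma_eq_iff:
  fixes U V :: "'a \<Rightarrow> real"
  assumes I: "finite I" and U: "integrable M U" and V: "integrable M V"
    and W: "\<And>i. i \<in> I \<Longrightarrow> W i \<in> borel_measurable M"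
  shows "(AE x in M. real_cond_exp M (gen_sigma M I W) U x = real_cond_exp M (gen_sigma M I W) V x)
    \<longleftrightarrow> (\<forall>t. (CLINT x|M. (U x - V x) * (\<Prod>i\<in>I. iexp (t i * W i x))) = 0)"
proof -
  let ?F = "gen_sigma M I W"
  interpret finite_measure_subalgebra M ?F
    by unfold_locales (rule subalgebra_gen_sigma[OF W])
  have UV: "integrable M (\<lambda>x. U x - V x)"
    using U V by simp
  have "(AE x in M. real_cond_exp M ?F U x = real_cond_exp M ?F V x)
      \<longleftrightarrow> (AE x in M. real_cond_exp M ?F (\<lambda>x. U x - V x) x = 0)"
    using real_cond_exp_diff[OF U V] by (intro eventually_cong) auto
  also have "\<dots> \<longleftrightarrow> (\<forall>t. (CLINT x|M. (U x - V x) * (\<Prod>i\<in>I. iexp (t i * W i x))) = 0)"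
  proof (intro iffI allI)
    fix t
    assume zero: "AE x in M. real_cond_exp M ?F (\<lambda>x. U x - V x) x = 0"
    \<comment> \<open>\<open>real_cond_exp\<close> acts on real functions, so orthogonality is
      proved for real \<open>f\<close> and then applied to the real and imaginary parts of the
      character.\<close>
    have orth: "(\<integral>x. (U x - V x) * f x \<partial>M) = 0"
      if f: "f \<in> borel_measurable ?F" "\<And>x. norm (f x) \<le> 1" for f :: "'a \<Rightarrow> real"
    proof -
      have "(\<integral>x. f x * (U x - V x) \<partial>M) = (\<integral>x. f x * real_cond_exp M ?F (\<lambda>x. U x - V x) x \<partial>M)"
        using UV f integrable_mult_bounded[OF UV measurable_from_subalg[OF subalg f(1)]]
        by (intro real_cond_exp_intg(2)[symmetric]) (auto simp: mult.commute)
      also have "\<dots> = 0"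
        using zero by (intro integral_eq_zero_AE) auto
      finally show ?thesis by (simp add: mult.commute)
    qed
    let ?g = "\<lambda>x. \<Prod>i\<in>I. iexp (t i * W i x)"
    have g[measurable]: "?g \<in> borel_measurable ?F"
      using measurable_gen_sigma[of _ I W M] by measurable
    have norm_g: "norm (?g x) = 1" for x
      by (simp add: prod_norm[symmetric])
    have "integrable M (\<lambda>x. complex_of_real (U x - V x) * ?g x)"
      using UV measurable_from_subalg[OF subalg g] by (intro integrable_mult_bounded) (auto simp: prod_norm[symmetric] simp del: of_real_diff)
    then have "Re (CLINT x|M. (U x - V x) * ?g x) = (\<integral>x. (U x - V x) * Re (?g x) \<partial>M)"
      and "Im (CLINT x|M. (U x - V x) * ?g x) = (\<integral>x. (U x - V x) * Im (?g x) \<partial>M)"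
      by (auto simp: integral_Re[symmetric] integral_Im[symmetric] simp del: integral_Re integral_Im)
    moreover have "norm (Re (?g x)) \<le> 1" "norm (Im (?g x)) \<le> 1" for x
      using abs_Re_le_cmod[of "?g x"] abs_Im_le_cmod[of "?g x"] norm_g[of x] by auto
    ultimately show "(CLINT x|M. (U x - V x) * ?g x) = 0"
      using orth[of "\<lambda>x. Re (?g x)"] orth[of "\<lambda>x. Im (?g x)"] g
      by (simp add: complex_eq_iff)
  next
    assume zero: "\<forall>t. (CLINT x|M. (U x - V x) * (\<Prod>i\<in>I. iexp (t i * W i x))) = 0"
    show "AE x in M. real_cond_exp M ?F (\<lambda>x. U x - V x) x = 0"
      using UV zero by (intro real_cond_exp_charact)
        (auto simp: set_integral_gen_sigma_eq_0[OF I UV W] simp del: of_real_diff)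
  qed
  finally show ?thesis .
qed

subsection \<open>Logarithmic derivatives of characteristic functions\<close>

text \<open>
  The logarithmic derivative of the characteristic function, divided by the imaginary unit.
\<close>

definition log_char_deriv :: "real measure \<Rightarrow> real \<Rightarrow> complex" where
  "log_char_deriv P u = (CLINT x|P. x * iexp (u * x)) / char P u"

lemma iexp_shift: "iexp (y * x) = iexp (u * x) * iexp ((y - u) * x)"
  unfolding exp_add[symmetric] by (simp add: left_diff_distrib right_diff_distrib)

context real_distribution
begin

context
  assumes square: "integrable M (\<lambda>x. x\<^sup>2)"
begin

lemma integrable_ident: "integrable M (\<lambda>x. x)"
  using square by (rule square_integrable_imp_integrable[rotated]) simp

lemma integrable_times_iexp: "integrable M (\<lambda>x. complex_of_real x * iexp (u * x))"
  using integrable_ident by (intro integrable_mult_bounded) auto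

text \<open>The first-order Taylor remainder of \<open>iexp\<close> is quadratic in its argument, so
  the finite second moment bounds the error of the difference quotient by a multiple of
  \<open>\<bar>y - u\<bar>\<close>.\<close>

lemma char_has_vector_derivative:
  "(char M has_vector_derivative \<i> * (CLINT x|M. x * iexp (u * x))) (at u)"
  unfolding has_vector_derivative_def
proof (rule has_derivativeI_sandwich[of 1 _ _ _ _ "\<lambda>y. \<bar>y - u\<bar> * expectation (\<lambda>x. x\<^sup>2)"])
  show "((\<lambda>y. \<bar>y - u\<bar> * expectation (\<lambda>x. x\<^sup>2)) \<longlongrightarrow> 0) (at u)"
    by (auto intro!: tendsto_eq_intros)
  fix y assume "y \<noteq> u"
  let ?h = "y - u"
  \<comment> \<open>The Taylor remainder with the factor \<open>iexp (u * x)\<close>, of modulus 1,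
    pulled out.\<close>
  let ?r = "\<lambda>x. iexp (u * x) * (iexp (?h * x) - (1 + \<i> * (?h * x)))"
  have "char M y - char M u - ?h *\<^sub>R (\<i> * (CLINT x|M. x * iexp (u * x)))
      = (CLINT x|M. iexp (y * x) - iexp (u * x) - (\<i> * ?h) * (x * iexp (u * x)))"
    unfolding char_def
    using integrable_times_iexp[of u] integrable_iexp[of "\<lambda>x. u * x"] integrable_iexp[of "\<lambda>x. y * x"]
    by (simp add: scaleR_conv_of_real)
  also have "\<dots> = (CLINT x|M. ?r x)"
  proof (intro Bochner_Integration.integral_cong refl)
    show "iexp (y * x) - iexp (u * x) - (\<i> * ?h) * (x * iexp (u * x)) = ?r x" for x
      unfolding iexp_shift[of y x u] right_diff_distrib distrib_left by simp
  qed
  finally have "norm (char M y - char M u - ?h *\<^sub>R (\<i> * (CLINT x|M. x * iexp (u * x))))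
      = norm (CLINT x|M. ?r x)"
    by (rule arg_cong)
  also have "\<dots> \<le> (\<integral>x. ?h\<^sup>2 * x\<^sup>2 \<partial>M)"
  proof (intro Bochner_Integration.integral_norm_bound_integral)
    have "integrable M (\<lambda>x. (iexp (?h * x) - (1 + \<i> * (?h * x))) * iexp (u * x))"
      using integrable_ident integrable_iexp[of "\<lambda>x. ?h * x"]
      by (intro integrable_mult_bounded) auto
    then show "integrable M ?r"
      by (simp only: mult.commute)
    fix x
    have "norm (?r x) = norm (iexp (?h * x) - (1 + \<i> * (?h * x)))"
      by (simp add: norm_mult)
    also have "\<dots> \<le> (?h * x)\<^sup>2 / 2"
      using iexp_approx1[of "?h * x" 1] by (simp add: numeral_2_eq_2)
    also have "\<dots> \<le> ?h\<^sup>2 * x\<^sup>2"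
      by (simp add: power_mult_distrib)
    finally show "norm (?r x) \<le> ?h\<^sup>2 * x\<^sup>2" .
  qed (use square in simp)
  also have "\<dots> = ?h\<^sup>2 * expectation (\<lambda>x. x\<^sup>2)"
    by simp
  finally have "norm (char M y - char M u - ?h *\<^sub>R (\<i> * (CLINT x|M. x * iexp (u * x)))) / \<bar>?h\<bar>
      \<le> ?h\<^sup>2 * expectation (\<lambda>x. x\<^sup>2) / \<bar>?h\<bar>"
    by (rule divide_right_mono) simp
  also have "\<dots> = \<bar>?h\<bar> * expectation (\<lambda>x. x\<^sup>2)"
  proof -
    have "a\<^sup>2 * b / \<bar>a\<bar> = \<bar>a\<bar> * b" if "a \<noteq> 0" for a b :: real
      using that by (simp add: power2_eq_square abs_if)
    then show ?thesis using \<open>y \<noteq> u\<close> by simp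
  qed
  finally show "norm (char M y - char M u - (y - u) *\<^sub>R (\<i> * (CLINT x|M. x * iexp (u * x)))) / norm (y - u)
      \<le> \<bar>y - u\<bar> * expectation (\<lambda>x. x\<^sup>2)"
    by simp
qed (auto intro!: bounded_linear_intros)

text \<open>Since \<open>iexp\<close> is 1-Lipschitz, the integral is Lipschitz in \<open>u\<close>
  with the second moment as constant.\<close>

lemma continuous_on_integral_times_iexp:
  "continuous_on UNIV (\<lambda>u. CLINT x|M. x * iexp (u * x))"
proof -
  let ?m = "\<lambda>u. CLINT x|M. x * iexp (u * x)"
  have "dist (?m y) (?m u) \<le> expectation (\<lambda>x. x\<^sup>2) * dist y u" for y u
  proof -
    have "?m y - ?m u = (CLINT x|M. x * iexp (y * x) - x * iexp (u * x))"
      using integrable_times_iexp by simp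
    also have "norm \<dots> \<le> (\<integral>x. \<bar>y - u\<bar> * x\<^sup>2 \<partial>M)"
    proof (rule Bochner_Integration.integral_norm_bound_integral)
      fix x
      have "x * iexp (y * x) - x * iexp (u * x) = (x * iexp (u * x)) * (iexp ((y - u) * x) - 1)"
        unfolding iexp_shift[of y x u] by (simp only: right_diff_distrib mult.assoc mult_1_right)
      also have "norm \<dots> \<le> \<bar>x\<bar> * \<bar>(y - u) * x\<bar>"
        using iexp_approx1[of "(y - u) * x" 0] by (simp add: norm_mult mult_left_mono)
      finally show "norm (x * iexp (y * x) - x * iexp (u * x)) \<le> \<bar>y - u\<bar> * x\<^sup>2"
        by (simp add: abs_mult power2_eq_square mult_ac)
    qed (use integrable_times_iexp square in simp_all)
    finally show ?thesis
      by (simp add: dist_norm mult.commute)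
  qed
  then have "(expectation (\<lambda>x. x\<^sup>2))-lipschitz_on UNIV ?m"
    by (intro lipschitz_onI) auto
  then show ?thesis
    by (rule lipschitz_on_continuous_on)
qed

lemma continuous_on_log_char_deriv:
  "(\<And>u. char M u \<noteq> 0) \<Longrightarrow> continuous_on UNIV (log_char_deriv M)"
  unfolding log_char_deriv_def
  by (intro continuous_intros continuous_on_integral_times_iexp)
     (auto simp: continuous_on_eq_continuous_at isCont_char)

end

lemma log_char_deriv_0: "log_char_deriv M 0 = expectation (\<lambda>x. x)"
  by (simp add: log_char_deriv_def char_zero)

text \<open>Conjugation only reverses the frequency, as \<open>x\<close> is real. This symmetry
  later forces the slope of the linear function to be purely imaginary.\<close>

lemma log_char_deriv_uminus: "log_char_deriv M (- u) = cnj (log_char_deriv M u)"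
proof -
  have "(CLINT x|M. x * iexp (- u * x)) = cnj (CLINT x|M. x * iexp (u * x))"
    by (subst Bochner_Integration.integral_cnj[symmetric]) (simp add: exp_cnj)
  moreover have "char M (- u) = cnj (char M u)"
    unfolding char_def by (subst Bochner_Integration.integral_cnj[symmetric]) (simp add: exp_cnj)
  ultimately show ?thesis
    by (simp add: log_char_deriv_def)
qed

end

section \<open>Cauchy's functional equation\<close>

text \<open>Additivity gives the formula at integer multiples and hence on the rationals; density
  and continuity give the rest.\<close>

lemma additive_continuous_imp_linear:
  fixes f :: "real \<Rightarrow> 'b::real_normed_vector"
  assumes add: "\<And>x y. f (x + y) = f x + f y" and cont: "continuous_on UNIV f"
  shows "f x = x *\<^sub>R f 1"
proof -
  interpret additive f by unfold_locales (rule add)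
  have of_nat: "f (of_nat k * x) = of_nat k *\<^sub>R f x" for k x
    by (induction k) (auto simp: zero add algebra_simps)
  have of_int: "f (of_int k * x) = of_int k *\<^sub>R f x" for k x
    by (cases k rule: int_cases2) (auto simp: of_nat minus)
  have rational: "f q = q *\<^sub>R f 1" if "q \<in> \<rat>" for q
  proof -
    obtain a b where q: "q = real_of_int a / real_of_int b" "b \<noteq> 0"
      using \<open>q \<in> \<rat>\<close> by (auto elim!: Rats_cases')
    have "of_int b *\<^sub>R f q = of_int a *\<^sub>R f 1"
      using of_int[of b q] of_int[of a 1] q by simp
    then have "(1 / of_int b) *\<^sub>R (of_int b *\<^sub>R f q) = (1 / of_int b) *\<^sub>R (of_int a *\<^sub>R f 1)"
      by simp
    then show ?thesis using q by simp
  qed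
  have "f q - q *\<^sub>R f 1 = 0" if "q \<in> \<rat>" for q
    by (subst right_minus_eq) (rule rational[OF that])
  \<comment> \<open>The deviation from linearity vanishes on the rationals, hence on their closure,
    the whole line.\<close>
  moreover have "continuous_on (closure \<rat>) (\<lambda>x. f x - x *\<^sub>R f 1)"
    by (rule continuous_on_diff[OF continuous_on_subset[OF cont subset_UNIV]
        continuous_on_scaleR[OF continuous_on_id continuous_on_const]])
  ultimately have "f x - x *\<^sub>R f 1 = 0"
    using continuous_constant_on_closure[of \<rat> "\<lambda>x. f x - x *\<^sub>R f 1" 0 x]
    unfolding Rats_closure_real by blast
  then show ?thesis by simp
qed

section \<open>Linear logarithmic derivatives and quadratic exponential factors\<close>

lemma has_vector_derivative_exp_quadratic:
  fixes a b :: complex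
  shows "((\<lambda>u. exp (a * of_real u + b * (of_real u)\<^sup>2 / 2)) has_vector_derivative
    (a + b * of_real u) * exp (a * of_real u + b * (of_real u)\<^sup>2 / 2)) (at u)"
  by (rule has_vector_derivative_real_field) (auto intro!: derivative_eq_intros)

text \<open>The quotient of the characteristic functions, multiplied by
  \<open>exp (s * u\<^sup>2 / 2)\<close>, has derivative zero and equals 1 at the origin.\<close>

lemma log_char_deriv_linear_imp_char_eq:
  assumes P: "real_distribution P" "integrable P (\<lambda>x. x\<^sup>2)" "\<And>u. char P u \<noteq> 0"
    and Q: "real_distribution Q" "integrable Q (\<lambda>x. x\<^sup>2)" "\<And>u. char Q u \<noteq> 0"
    and lin: "\<And>u. log_char_deriv P u - log_char_deriv Q u = u *\<^sub>R c"
  shows "\<exists>s::real. \<forall>u. char P u = char Q u * exp (- (s * u\<^sup>2 / 2))"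
proof -
  interpret P: real_distribution P by fact
  interpret Q: real_distribution Q by fact
  \<comment> \<open>Compare the linear relation at 1 and at -1, where the left side is
    conjugated.\<close>
  have "cnj c = - c"
    using lin[of 1] lin[of "-1"] P.log_char_deriv_uminus[of 1] Q.log_char_deriv_uminus[of 1]
    by (metis complex_cnj_diff scaleR_minus_left scaleR_one)
  define s where "s = Im c"
  then have c: "c = \<i> * s"
    using \<open>cnj c = - c\<close> by (simp add: complex_eq_iff)
  let ?m = "\<lambda>P u. CLINT x|P. x * iexp (u * x)"
  \<comment> \<open>The zero linear term keeps the shape of
    \<open>has_vector_derivative_exp_quadratic\<close>.\<close>
  let ?e = "\<lambda>u. exp (0 * complex_of_real u + complex_of_real s * (complex_of_real u)\<^sup>2 / 2)"
  define h where "h u = char P u * inverse (char Q u) * ?e u" for u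
  have "(h has_vector_derivative 0) (at u)" for u
  proof -
    have "((\<lambda>u. inverse (char Q u)) has_vector_derivative
        (\<i> * ?m Q u) * (- (inverse (char Q u) ^ Suc (Suc 0)))) (at u)"
      using field_vector_diff_chain_at[OF Q.char_has_vector_derivative[OF Q(2)] DERIV_inverse] Q(3)
      by (simp add: o_def)
    from has_vector_derivative_mult[OF has_vector_derivative_mult[OF
        P.char_has_vector_derivative[OF P(2)] this] has_vector_derivative_exp_quadratic]
    have "(h has_vector_derivative
        char P u * inverse (char Q u) * ((0 + complex_of_real s * of_real u) * ?e u)
        + (char P u * ((\<i> * ?m Q u) * (- (inverse (char Q u) ^ Suc (Suc 0))))
          + \<i> * ?m P u * inverse (char Q u)) * ?e u) (at u)"
      unfolding h_def .
    moreover have m: "?m P u = log_char_deriv P u * char P u" "?m Q u = log_char_deriv Q u * char Q u"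
      using P(3) Q(3) by (simp_all add: log_char_deriv_def)
    moreover have l: "log_char_deriv P u = log_char_deriv Q u + \<i> * s * u"
      using lin[of u] by (simp add: c scaleR_conv_of_real algebra_simps)
    \<comment> \<open>This is the cancellation in the derivative of \<open>h\<close>:
      \<open>p\<close> and \<open>q\<close> stand for the characteristic functions of
      \<open>P\<close> and \<open>Q\<close>, \<open>l\<close> for the logarithmic derivative of
      \<open>Q\<close>, and \<open>e\<close> for the exponential.\<close>
    moreover have "p * inverse q * ((0 + complex_of_real s * of_real u) * e)
        + (p * ((\<i> * (l * q)) * (- (inverse q ^ Suc (Suc 0))))
          + \<i> * ((l + \<i> * s * u) * p) * inverse q) * e = 0" if "q \<noteq> 0" for p q l e :: complex
      using that by (simp add: field_simps)
    note this[OF Q(3)[of u]]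
    ultimately show ?thesis
      by (simp only: m l)
  qed
  then have "h u = h 0" for u
    by (intro has_derivative_zero_unique[of UNIV])
       (auto simp: has_vector_derivative_def)
  then have "h u = 1" for u
    by (simp add: h_def P.char_zero Q.char_zero)
  then have "char P u = char Q u * exp (- (s * u\<^sup>2 / 2))" for u
    using Q(3)[of u] by (simp add: h_def exp_of_real[symmetric] exp_minus divide_simps)
  then show ?thesis by blast
qed

text \<open>The converse direction: differentiate the product and divide by it. The mean
  \<open>m\<close> appears because the Gaussian summand need not be centred a priori.\<close>

lemma log_char_deriv_diff_of_char_eq:
  fixes m s :: real
  assumes P: "real_distribution P" "integrable P (\<lambda>x. x\<^sup>2)"
    and Q: "real_distribution Q" "integrable Q (\<lambda>x. x\<^sup>2)" "\<And>u. char Q u \<noteq> 0"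
    and eq: "\<And>u. char P u = char Q u * (iexp (m * u) * exp (- (s * u\<^sup>2 / 2)))"
  shows "log_char_deriv P u - log_char_deriv Q u = m + \<i> * s * u"
proof -
  interpret P: real_distribution P by fact
  interpret Q: real_distribution Q by fact
  let ?m = "\<lambda>P u. CLINT x|P. x * iexp (u * x)"
  define e where "e u = exp ((\<i> * m) * complex_of_real u + (- complex_of_real s) * (complex_of_real u)\<^sup>2 / 2)" for u
  have eq': "char P u = char Q u * e u" for u
    unfolding eq e_def by (simp add: exp_of_real[symmetric] exp_add[symmetric] mult.assoc)
  have "(e has_vector_derivative (\<i> * m - s * u) * e u) (at u)"
    using has_vector_derivative_exp_quadratic[of "\<i> * m" "- complex_of_real s" u]
    unfolding e_def by simp
  from has_vector_derivative_mult[OF Q.char_has_vector_derivative[OF Q(2)] this]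
  have "(char P has_vector_derivative char Q u * ((\<i> * m - s * u) * e u) + \<i> * ?m Q u * e u) (at u)"
    unfolding eq'[symmetric] .
  \<comment> \<open>The general formula and the product rule both give the derivative of
    \<open>char P\<close>.\<close>
  then have deriv_eq: "\<i> * ?m P u = char Q u * ((\<i> * m - s * u) * e u) + \<i> * ?m Q u * e u"
    by (intro vector_derivative_unique_at[OF P.char_has_vector_derivative[OF P(2)]])
  have "?m P u = - \<i> * (\<i> * ?m P u)"
    by (simp add: mult.assoc[symmetric])
  also have "\<dots> = char Q u * ((m + \<i> * s * u) * e u) + ?m Q u * e u"
    unfolding deriv_eq by (simp add: algebra_simps)
  finally have "?m P u = char Q u * ((m + \<i> * s * u) * e u) + ?m Q u * e u" .
  moreover have "e u \<noteq> 0"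
    by (simp add: e_def)
  ultimately show ?thesis
    unfolding log_char_deriv_def eq' using Q(3)[of u] by (simp add: field_simps)
qed

subsection \<open>Gaussian factors\<close>

text \<open>Standardising reduces this to the standard normal distribution; the shift by
  \<open>m\<close> contributes the factor \<open>iexp (m * u)\<close>.\<close>

lemma (in prob_space) char_distr_normal:
  assumes \<xi>: "distributed M lborel \<xi> (normal_density m \<sigma>)" and \<sigma>: "0 < \<sigma>"
  shows "char (distr M borel \<xi>) u = iexp (m * u) * exp (- (\<sigma>\<^sup>2 * u\<^sup>2 / 2))"
proof -
  have [measurable]: "\<xi> \<in> borel_measurable M"
    using distributed_measurable[OF \<xi>] by simp
  let ?Z = "\<lambda>\<omega>. (\<xi> \<omega> - m) / \<sigma>"
  have "distributed M lborel ?Z std_normal_density"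
    by (rule normal_standard_normal_convert[OF \<sigma>, THEN iffD1, OF \<xi>])
  then have Z: "distr M borel ?Z = std_normal_distribution"
    by (simp add: distributed_distr_eq_density[symmetric] cong: distr_cong)
  have shift: "iexp (u * \<xi> \<omega>) = iexp (m * u) * iexp ((\<sigma> * u) * ?Z \<omega>)" for \<omega>
    using \<sigma> unfolding exp_add[symmetric] of_real_mult[symmetric] of_real_add[symmetric] distrib_left[symmetric]
    by (intro arg_cong[where f = "\<lambda>x. exp (\<i> * complex_of_real x)"]) (simp add: field_simps)
  have "char (distr M borel \<xi>) u = (CLINT \<omega>|M. iexp (u * \<xi> \<omega>))"
    unfolding char_def by (subst integral_distr) auto
  also have "\<dots> = iexp (m * u) * (CLINT \<omega>|M. iexp ((\<sigma> * u) * ?Z \<omega>))"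
    unfolding shift by (rule integral_mult_right_zero)
  also have "(CLINT \<omega>|M. iexp ((\<sigma> * u) * ?Z \<omega>)) = char (distr M borel ?Z) (\<sigma> * u)"
    unfolding char_def by (subst integral_distr) auto
  finally show ?thesis
    by (simp add: Z char_std_normal_distribution power_mult_distrib)
qed

text \<open>The auxiliary space is the plane with the product of the law of \<open>Y\<close> and the
  standard normal law. The first coordinate is a copy of \<open>Y\<close>, and the second, scaled by
  \<open>sqrt s\<close>, is an independent Gaussian of variance \<open>s\<close>; Levy's theorem
  identifies the law of the sum.\<close>

lemma (in prob_space) char_eq_imp_eq_distr_plus_gaussian:
  assumes X: "X \<in> borel_measurable M" and Y: "Y \<in> borel_measurable M" and s: "0 < s"
    and eq: "\<And>u. char (distr M borel X) u = char (distr M borel Y) u * exp (- (s * u\<^sup>2 / 2))"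
  shows "eq_distr_plus_gaussian M X Y"
proof -
  let ?Y = "distr M borel Y" and ?S = std_normal_distribution
  let ?N = "?Y \<Otimes>\<^sub>M ?S" and ?\<xi> = "\<lambda>\<omega>. sqrt s * snd \<omega>"
  interpret PX: real_distribution "distr M borel X"
    using X by (rule real_distribution_distr)
  interpret PY: real_distribution ?Y
    using Y by (rule real_distribution_distr)
  interpret S: real_distribution ?S
    by (rule real_dist_normal_dist)
  interpret N: pair_prob_space ?Y ?S ..
  have sets_N: "sets ?N = sets (borel \<Otimes>\<^sub>M borel)"
    by (intro sets_pair_measure_cong) auto
  have [measurable]: "fst \<in> borel_measurable ?N" "snd \<in> borel_measurable ?N"
    unfolding measurable_cong_sets[OF sets_N refl] by auto
  have fst: "distr ?N borel fst = ?Y"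
    using S.distr_pair_fst[of ?Y] by (simp cong: distr_cong)
  have snd: "distr ?N borel snd = ?S"
  proof (rule measure_eqI)
    fix A assume "A \<in> sets (distr ?N borel snd)"
    then have [measurable]: "A \<in> sets borel" by simp
    have "emeasure (distr ?N borel snd) A = emeasure ?N (space ?Y \<times> A)"
      by (subst emeasure_distr)
         (auto simp: space_pair_measure intro!: arg_cong2[where f = emeasure])
    also have "\<dots> = emeasure ?S A"
      using PY.emeasure_space_1 by (subst S.emeasure_pair_measure_Times) auto
    finally show "emeasure (distr ?N borel snd) A = emeasure ?S A" .
  qed simp
  \<comment> \<open>Independence means that the joint law is the product law; the pair of
    coordinates is the identity map of the product space.\<close>
  have "N.indep_var borel fst borel snd"
    unfolding N.indep_var_distribution_eq fst snd
    using distr_id2[OF sets_N[symmetric]] by simp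
  then have indep: "N.indep_var borel fst borel ?\<xi>"
    using N.indep_var_compose[of borel fst borel snd id borel "\<lambda>x. sqrt s * x" borel]
    by (simp add: o_def)
  have "distributed ?N lborel snd std_normal_density"
    unfolding distributed_def using snd
    by (auto cong: distr_cong)
  from N.normal_density_affine[OF this, of "sqrt s" 0]
  have \<xi>: "distributed ?N lborel ?\<xi> (normal_density 0 (sqrt s))"
    using s by simp
  have "distr M borel X = distr ?N borel (\<lambda>\<omega>. fst \<omega> + ?\<xi> \<omega>)"
  proof (rule Levy_uniqueness)
    show "real_distribution (distr ?N borel (\<lambda>\<omega>. fst \<omega> + ?\<xi> \<omega>))"
      by (rule N.real_distribution_distr) measurable
    show "char (distr M borel X) = char (distr ?N borel (\<lambda>\<omega>. fst \<omega> + ?\<xi> \<omega>))"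
      using s unfolding N.char_distr_add[OF indep] fst N.char_distr_normal[OF \<xi> real_sqrt_gt_zero[OF s]] eq fun_eq_iff
      by simp
  qed (rule PX.real_distribution_axioms)
  moreover have "gaussian_rv ?N ?\<xi>"
    unfolding gaussian_rv_def using \<xi> s by (intro exI[of _ 0] exI[of _ "sqrt s"]) simp
  ultimately show ?thesis
    unfolding eq_distr_plus_gaussian_def using N.prob_space_axioms indep fst by blast
qed

lemma eq_distr_plus_gaussian_imp_char_eq:
  assumes "eq_distr_plus_gaussian M X Y"
  obtains m s :: real where "0 < s"
    and "\<And>u. char (distr M borel X) u
      = char (distr M borel Y) u * (iexp (m * u) * exp (- (s * u\<^sup>2 / 2)))"
proof -
  obtain N :: "(real \<times> real) measure" and U \<xi> m \<sigma> where N: "prob_space N"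
    and indep: "prob_space.indep_var N borel U borel \<xi>" and \<sigma>: "0 < \<sigma>"
    and \<xi>: "distributed N lborel \<xi> (normal_density m \<sigma>)"
    and U: "distr N borel U = distr M borel Y"
    and X: "distr M borel X = distr N borel (\<lambda>\<omega>. U \<omega> + \<xi> \<omega>)"
    using assms unfolding eq_distr_plus_gaussian_def gaussian_rv_def by blast
  interpret N: prob_space N by fact
  show thesis
  proof
    show "0 < \<sigma>\<^sup>2" using \<sigma> by simp
    show "char (distr M borel X) u
      = char (distr M borel Y) u * (iexp (m * u) * exp (- (\<sigma>\<^sup>2 * u\<^sup>2 / 2)))" for u
      unfolding X N.char_distr_add[OF indep] U N.char_distr_normal[OF \<xi> \<sigma>] ..
  qed
qed

lemma eq_distr_plus_gaussian_imp_has_gaussian_component: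
  "eq_distr_plus_gaussian M X Y \<Longrightarrow> has_gaussian_component M X"
  unfolding eq_distr_plus_gaussian_def has_gaussian_component_def by blast

section \<open>Factorisation under independence, and frequencies with sum zero\<close>

text \<open>Independence splits the integral into one factor per variable. Only the factor at
  \<open>k\<close> carries the extra \<open>Z k\<close>, and dividing by its nonzero characteristic
  function produces the logarithmic derivative.\<close>

lemma (in prob_space) integral_times_prod_iexp:
  fixes Z :: "'i \<Rightarrow> 'a \<Rightarrow> real" and v :: "'i \<Rightarrow> real"
  assumes I: "finite I" "k \<in> I" and indep: "indep_vars (\<lambda>_. borel) Z I"
    and int: "integrable M (Z k)" and nz: "char (distr M borel (Z k)) (v k) \<noteq> 0"
  shows "(CLINT \<omega>|M. Z k \<omega> * (\<Prod>l\<in>I. iexp (v l * Z l \<omega>)))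
    = log_char_deriv (distr M borel (Z k)) (v k) * (\<Prod>l\<in>I. char (distr M borel (Z l)) (v l))"
proof -
  have rv: "Z l \<in> borel_measurable M" if "l \<in> I" for l
    using indep that by (auto simp: indep_vars_def)
  \<comment> \<open>Attaching the weight to coordinate \<open>k\<close> makes the integrand a
    product of functions of single variables.\<close>
  let ?g = "\<lambda>l z. (if l = k then complex_of_real z else 1) * iexp (v l * z)"
  let ?D = "log_char_deriv (distr M borel (Z k)) (v k)"
  have "(CLINT \<omega>|M. Z k \<omega> * (\<Prod>l\<in>I. iexp (v l * Z l \<omega>))) = (CLINT \<omega>|M. \<Prod>l\<in>I. ?g l (Z l \<omega>))"
    using I by (simp add: prod.distrib prod.delta)
  also have "\<dots> = (\<Prod>l\<in>I. CLINT \<omega>|M. ?g l (Z l \<omega>))"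
  proof (rule indep_vars_lebesgue_integral[OF I(1)])
    show "indep_vars (\<lambda>_. borel) (\<lambda>l \<omega>. ?g l (Z l \<omega>)) I"
      by (rule indep_vars_compose2[OF indep]) measurable
    fix l assume l: "l \<in> I"
    note [measurable] = rv[OF l]
    show "integrable M (\<lambda>\<omega>. ?g l (Z l \<omega>))"
    proof (rule integrable_mult_bounded)
      show "integrable M (\<lambda>\<omega>. if l = k then complex_of_real (Z l \<omega>) else 1)"
        using int by (cases "l = k") auto
      show "(\<lambda>\<omega>. iexp (v l * Z l \<omega>)) \<in> borel_measurable M"
        by measurable
    qed simp
  qed
  also have "\<dots> = (\<Prod>l\<in>I. (if l = k then ?D else 1) * char (distr M borel (Z l)) (v l))"
  proof (rule prod.cong[OF refl])
    fix l assume l: "l \<in> I"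
    note [measurable] = rv[OF l]
    show "(CLINT \<omega>|M. ?g l (Z l \<omega>)) = (if l = k then ?D else 1) * char (distr M borel (Z l)) (v l)"
    proof (cases "l = k")
      case True
      then have "(CLINT \<omega>|M. ?g l (Z l \<omega>)) = (CLINT x|distr M borel (Z k). x * iexp (v k * x))"
        using rv[OF I(2)] by (subst integral_distr) auto
      then show ?thesis
        using nz True by (simp add: log_char_deriv_def)
    next
      case False
      then show ?thesis
        unfolding char_def by (subst integral_distr) auto
    qed
  qed
  also have "\<dots> = ?D * (\<Prod>l\<in>I. char (distr M borel (Z l)) (v l))"
    using I by (simp add: prod.distrib prod.delta)
  finally show ?thesis .
qed

text \<open>Subtracting the sum over \<open>N\<close> from each coordinate is a symmetric linear
  map, so it can be moved from the variables to the frequencies.\<close>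

lemma sum_times_centered:
  fixes t x :: "'i \<Rightarrow> real"
  assumes "finite I"
  shows "(\<Sum>i\<in>I. t i * (x i - (\<Sum>j\<in>I. x j) / N)) = (\<Sum>i\<in>I. (t i - (\<Sum>j\<in>I. t j) / N) * x i)"
  by (simp add: algebra_simps sum_subtractf sum_divide_distrib[symmetric]
      sum_distrib_left[symmetric] sum_distrib_right[symmetric])

text \<open>Three slots suffice: place \<open>a\<close>, \<open>b\<close> and
  \<open>- (a + b)\<close> there and 0 in all the others.\<close>

lemma additive_of_zero_sum:
  fixes \<phi> :: "real \<Rightarrow> 'b::ab_group_add"
  assumes n: "n \<ge> (3::nat)" and zero: "\<phi> 0 = 0"
    and sum: "\<And>u. (\<Sum>k=1..n. u k) = 0 \<Longrightarrow> (\<Sum>k=1..n. \<phi> (u k)) = 0"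
  shows "\<phi> (a + b) = \<phi> a + \<phi> b"
proof -
  have three: "\<phi> a + \<phi> b + \<phi> c = 0" if "a + b + c = 0" for a b c
  proof -
    define u where "u k = (if k = 1 then a else if k = 2 then b else if k = 3 then c else 0)" for k :: nat
    \<comment> \<open>Stated for general \<open>f\<close>, so that the identity verifies the
      zero-sum condition and \<open>\<phi>\<close> gives the conclusion.\<close>
    have "(\<Sum>k=1..n. f (u k)) = f a + f b + f c" if "f 0 = 0" for f :: "real \<Rightarrow> 'c::ab_group_add"
    proof -
      have "(\<Sum>k=1..n. f (u k)) = (\<Sum>k\<in>{1, 2, 3}. f (u k))"
        using n that by (intro sum.mono_neutral_right) (auto simp: u_def)
      then show ?thesis by (simp add: u_def add.assoc)
    qed
    from this[of "\<lambda>x. x"] this[of \<phi>] show ?thesis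
      using sum[of u] that zero by simp
  qed
  \<comment> \<open>The triple with third entry 0 shows that \<open>\<phi>\<close> is odd at
    \<open>a + b\<close>.\<close>
  have "\<phi> (a + b) + \<phi> (- (a + b)) = 0" "\<phi> a + \<phi> b + \<phi> (- (a + b)) = 0"
    using three[of "a + b" "- (a + b)" 0] three[of a b "- (a + b)"] zero by auto
  then show ?thesis by (metis add_right_cancel)
qed

subsection \<open>Sample means and residuals\<close>

text \<open>A Gaussian summand makes the difference affine in \<open>u\<close>; equality of the
  means removes the constant term.\<close>

lemma eq_distr_plus_gaussian_imp_log_char_deriv_linear:
  fixes X Y :: "'a \<Rightarrow> real"
  assumes P: "real_distribution P" "integrable P (\<lambda>x. x\<^sup>2)" "(\<integral>x. x \<partial>P) = 0"
    and Q: "real_distribution Q" "integrable Q (\<lambda>x. x\<^sup>2)" "(\<integral>x. x \<partial>Q) = 0" "\<And>u. char Q u \<noteq> 0"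
    and gauss: "eq_distr_plus_gaussian M X Y"
    and distr: "distr M borel X = P" "distr M borel Y = Q"
  shows "\<exists>c. \<forall>u. log_char_deriv P u - log_char_deriv Q u = u *\<^sub>R c"
proof -
  interpret P: real_distribution P by fact
  interpret Q: real_distribution Q by fact
  obtain m s :: real where "\<And>u. char P u = char Q u * (iexp (m * u) * exp (- (s * u\<^sup>2 / 2)))"
    using eq_distr_plus_gaussian_imp_char_eq[OF gauss] unfolding distr by blast
  from log_char_deriv_diff_of_char_eq[OF P(1,2) Q(1,2,4) this]
  have diff: "log_char_deriv P u - log_char_deriv Q u = m + \<i> * s * u" for u .
  from this[of 0] have "m = 0"
    using P(3) Q(3) by (simp add: P.log_char_deriv_0 Q.log_char_deriv_0)
  then show ?thesis
    using diff by (intro exI[of _ "\<i> * s"]) (simp add: scaleR_conv_of_real)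
qed

lemma prod_iexp: "finite I \<Longrightarrow> (\<Prod>i\<in>I. iexp (f i)) = iexp (\<Sum>i\<in>I. f i)"
  by (simp add: exp_sum sum_distrib_left)

text \<open>A character of the residuals at \<open>t\<close> is a character of the original
  variables at the centred frequencies \<open>u\<close>, the same for both samples. Each summand of
  the two means then contributes one logarithmic derivative times the common product of
  characteristic functions.\<close>

lemma (in prob_space) integral_sample_means_times_prod_iexp:
  fixes X Y :: "nat \<Rightarrow> 'a \<Rightarrow> real" and t :: "nat \<Rightarrow> real" and n :: nat
  defines "u \<equiv> \<lambda>k. t k - (\<Sum>j=1..n. t j) / real n"
  assumes indep: "indep_vars (\<lambda>_. borel) (case_sum X Y) ({1..n} <+> {1..n})"
    and P: "\<And>i. i \<in> {1..n} \<Longrightarrow> distr M borel (X i) = P" "\<And>u. char P u \<noteq> 0"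
    and Q: "\<And>i. i \<in> {1..n} \<Longrightarrow> distr M borel (Y i) = Q" "\<And>u. char Q u \<noteq> 0"
    and intX: "\<And>i. i \<in> {1..n} \<Longrightarrow> integrable M (X i)"
    and intY: "\<And>i. i \<in> {1..n} \<Longrightarrow> integrable M (Y i)"
  shows "(CLINT \<omega>|M. (sample_mean n X \<omega> - sample_mean n Y \<omega>) * (\<Prod>i=1..n.
      iexp (t i * (X i \<omega> - sample_mean n X \<omega> + Y i \<omega> - sample_mean n Y \<omega>))))
    = (\<Sum>k=1..n. log_char_deriv P (u k) - log_char_deriv Q (u k)) / n
      * ((\<Prod>k=1..n. char P (u k)) * (\<Prod>k=1..n. char Q (u k)))"
proof -
  let ?I = "{1..n} <+> {1..n}"
  let ?v = "case_sum u u" and ?Z = "case_sum X Y"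
  let ?C = "(\<Prod>k=1..n. char P (u k)) * (\<Prod>k=1..n. char Q (u k))"
  define E where "E \<omega> = (\<Prod>l\<in>?I. iexp (?v l * ?Z l \<omega>))" for \<omega>
  have rv: "?Z l \<in> borel_measurable M" if "l \<in> ?I" for l
    using indep that by (auto simp: indep_vars_def)
  have E_measurable: "E \<in> borel_measurable M"
    unfolding E_def by (intro borel_measurable_prod) (use rv in measurable)
  have E_norm: "norm (E \<omega>) \<le> 1" for \<omega>
    by (simp add: E_def prod_norm[symmetric])
  have "(\<Sum>i=1..n. t i * (X i \<omega> - sample_mean n X \<omega> + Y i \<omega> - sample_mean n Y \<omega>))
      = (\<Sum>l\<in>?I. ?v l * ?Z l \<omega>)" for \<omega>
  proof -
    let ?R = "\<lambda>i. X i \<omega> + Y i \<omega>"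
    have "(\<Sum>i=1..n. t i * (X i \<omega> - sample_mean n X \<omega> + Y i \<omega> - sample_mean n Y \<omega>))
        = (\<Sum>i=1..n. t i * (?R i - (\<Sum>j=1..n. ?R j) / n))"
      by (simp add: sample_mean_def sum.distrib add_divide_distrib algebra_simps)
    also have "\<dots> = (\<Sum>i=1..n. u i * ?R i)"
      unfolding u_def by (rule sum_times_centered) simp
    also have "\<dots> = (\<Sum>l\<in>?I. ?v l * ?Z l \<omega>)"
      by (subst sum.Plus) (simp_all add: o_def sum.distrib distrib_left)
    finally show ?thesis .
  qed
  then have E_eq: "(\<Prod>i=1..n. iexp (t i * (X i \<omega> - sample_mean n X \<omega> + Y i \<omega> - sample_mean n Y \<omega>)))
      = E \<omega>" for \<omega>
    unfolding E_def by (simp only: prod_iexp finite_atLeastAtMost finite_Plus)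
  have C: "(\<Prod>l\<in>?I. char (distr M borel (?Z l)) (?v l)) = ?C"
    by (subst prod.Plus) (simp_all add: P Q)
  have X: "(CLINT \<omega>|M. X k \<omega> * E \<omega>) = log_char_deriv P (u k) * ?C" if "k \<in> {1..n}" for k
    using integral_times_prod_iexp[OF _ InlI[OF that] indep, of ?v] that
    unfolding E_def[symmetric] C by (simp add: P intX)
  have Y: "(CLINT \<omega>|M. Y k \<omega> * E \<omega>) = log_char_deriv Q (u k) * ?C" if "k \<in> {1..n}" for k
    using integral_times_prod_iexp[OF _ InrI[OF that] indep, of ?v] that
    unfolding E_def[symmetric] C by (simp add: Q intY)
  have int_XE: "integrable M (\<lambda>\<omega>. complex_of_real (X k \<omega>) * E \<omega>)" if "k \<in> {1..n}" for k
    using intX[OF that] E_measurable E_norm by (intro integrable_mult_bounded) auto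
  have int_YE: "integrable M (\<lambda>\<omega>. complex_of_real (Y k \<omega>) * E \<omega>)" if "k \<in> {1..n}" for k
    using intY[OF that] E_measurable E_norm by (intro integrable_mult_bounded) auto
  have "(CLINT \<omega>|M. (sample_mean n X \<omega> - sample_mean n Y \<omega>) * E \<omega>)
      = (CLINT \<omega>|M. (\<Sum>k=1..n. X k \<omega> * E \<omega> - Y k \<omega> * E \<omega>) / n)"
    by (intro Bochner_Integration.integral_cong)
       (simp_all add: sample_mean_def sum_subtractf sum_distrib_right[symmetric] diff_divide_distrib left_diff_distrib)
  also have "\<dots> = (\<Sum>k=1..n. (CLINT \<omega>|M. X k \<omega> * E \<omega>) - (CLINT \<omega>|M. Y k \<omega> * E \<omega>)) / n"
    using int_XE int_YE by simp
  also have "\<dots> = (\<Sum>k=1..n. log_char_deriv P (u k) * ?C - log_char_deriv Q (u k) * ?C) / n"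
    by (intro arg_cong2[where f = "(/)"] sum.cong refl) (simp only: X Y)
  also have "\<dots> = (\<Sum>k=1..n. log_char_deriv P (u k) - log_char_deriv Q (u k)) / n * ?C"
    by (simp only: left_diff_distrib[symmetric] sum_distrib_right[symmetric] times_divide_eq_left)
  finally show ?thesis
    unfolding E_eq .
qed

text \<open>The product of characteristic functions is nonzero and cancels, and the centred
  frequency vectors are exactly those with sum zero.\<close>

lemma (in prob_space) real_cond_exp_sample_means_eq_iff:
  fixes X Y :: "nat \<Rightarrow> 'a \<Rightarrow> real" and n :: nat
  defines "F \<equiv> gen_sigma M {1..n}
      (\<lambda>i \<omega>. X i \<omega> - sample_mean n X \<omega> + Y i \<omega> - sample_mean n Y \<omega>)"
  assumes n: "n \<ge> 1"
    and indep: "indep_vars (\<lambda>_. borel) (case_sum X Y) ({1..n} <+> {1..n})"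
    and P: "\<And>i. i \<in> {1..n} \<Longrightarrow> distr M borel (X i) = P" "\<And>u. char P u \<noteq> 0"
    and Q: "\<And>i. i \<in> {1..n} \<Longrightarrow> distr M borel (Y i) = Q" "\<And>u. char Q u \<noteq> 0"
    and intX: "\<And>i. i \<in> {1..n} \<Longrightarrow> integrable M (X i)"
    and intY: "\<And>i. i \<in> {1..n} \<Longrightarrow> integrable M (Y i)"
  shows "(AE \<omega> in M. real_cond_exp M F (sample_mean n X) \<omega> = real_cond_exp M F (sample_mean n Y) \<omega>)
    \<longleftrightarrow> (\<forall>u. (\<Sum>k=1..n. u k) = 0
        \<longrightarrow> (\<Sum>k=1..n. log_char_deriv P (u k) - log_char_deriv Q (u k)) = 0)"
proof -
  let ?c = "\<lambda>t k. t k - (\<Sum>j=1..n. t j) / real n"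
  have int: "integrable M (sample_mean n X)" "integrable M (sample_mean n Y)"
    unfolding sample_mean_def[abs_def] using intX intY
    by (auto intro!: Bochner_Integration.integrable_divide Bochner_Integration.integrable_sum)
  have W: "(\<lambda>\<omega>. X i \<omega> - sample_mean n X \<omega> + Y i \<omega> - sample_mean n Y \<omega>) \<in> borel_measurable M"
    if "i \<in> {1..n}" for i
    using intX[OF that] intY[OF that] int by auto
  have "(AE \<omega> in M. real_cond_exp M F (sample_mean n X) \<omega> = real_cond_exp M F (sample_mean n Y) \<omega>)
      \<longleftrightarrow> (\<forall>t. (\<Sum>k=1..n. log_char_deriv P (?c t k) - log_char_deriv Q (?c t k)) / n
        * ((\<Prod>k=1..n. char P (?c t k)) * (\<Prod>k=1..n. char Q (?c t k))) = 0)"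
    unfolding F_def
    by (simp only: real_cond_exp_gen_sigma_eq_iff[OF finite_atLeastAtMost int W]
        integral_sample_means_times_prod_iexp[OF indep P Q intX intY])
  also have "\<dots> \<longleftrightarrow> (\<forall>t. (\<Sum>k=1..n. log_char_deriv P (?c t k) - log_char_deriv Q (?c t k)) = 0)"
    using n P(2) Q(2) by (simp add: prod_zero_iff)
  also have "\<dots> \<longleftrightarrow> (\<forall>u. (\<Sum>k=1..n. u k) = 0
        \<longrightarrow> (\<Sum>k=1..n. log_char_deriv P (u k) - log_char_deriv Q (u k)) = 0)"
  proof (intro iffI allI impI)
    fix u :: "nat \<Rightarrow> real"
    assume "\<forall>t. (\<Sum>k=1..n. log_char_deriv P (?c t k) - log_char_deriv Q (?c t k)) = 0"
    \<comment> \<open>A vector with sum zero is its own centring, so \<open>u\<close> itself serves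
      as \<open>t\<close>.\<close>
    then have "(\<Sum>k=1..n. log_char_deriv P (?c u k) - log_char_deriv Q (?c u k)) = 0" ..
    moreover assume "(\<Sum>k=1..n. u k) = 0"
    ultimately show "(\<Sum>k=1..n. log_char_deriv P (u k) - log_char_deriv Q (u k)) = 0"
      by simp
  next
    fix t :: "nat \<Rightarrow> real"
    assume zero: "\<forall>u. (\<Sum>k=1..n. u k) = 0
        \<longrightarrow> (\<Sum>k=1..n. log_char_deriv P (u k) - log_char_deriv Q (u k)) = 0"
    have "(\<Sum>k=1..n. ?c t k) = 0"
      using n by (simp add: sum_subtractf)
    then show "(\<Sum>k=1..n. log_char_deriv P (?c t k) - log_char_deriv Q (?c t k)) = 0"
      by (rule zero[rule_format])
  qed
  finally show ?thesis .
qed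

theorem theorem2:
  fixes M :: "'a measure" and X Y :: "nat \<Rightarrow> 'a \<Rightarrow> real" and n :: nat
  assumes "prob_space M"
    and "n \<ge> 3"
    and "prob_space.indep_vars M (\<lambda>_. borel) (case_sum X Y) ({1..n} <+> {1..n})"
    and "\<And>i j. i \<in> {1..n} \<Longrightarrow> j \<in> {1..n} \<Longrightarrow> distr M borel (X i) = distr M borel (X j)"
    and "\<And>i j. i \<in> {1..n} \<Longrightarrow> j \<in> {1..n} \<Longrightarrow> distr M borel (Y i) = distr M borel (Y j)"
    and "\<And>i. i \<in> {1..n} \<Longrightarrow> integrable M (\<lambda>\<omega>. (X i \<omega>)\<^sup>2)"
    and "\<And>i. i \<in> {1..n} \<Longrightarrow> integrable M (\<lambda>\<omega>. (Y i \<omega>)\<^sup>2)"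
    and "\<And>i. i \<in> {1..n} \<Longrightarrow> (\<integral>\<omega>. X i \<omega> \<partial>M) = 0"
    and "\<And>i. i \<in> {1..n} \<Longrightarrow> (\<integral>\<omega>. Y i \<omega> \<partial>M) = 0"
    and "\<And>i t. i \<in> {1..n} \<Longrightarrow> char (distr M borel (X i)) t \<noteq> 0"
    and "\<And>i t. i \<in> {1..n} \<Longrightarrow> char (distr M borel (Y i)) t \<noteq> 0"
  defines "F \<equiv> gen_sigma M {1..n}
      (\<lambda>i \<omega>. X i \<omega> - sample_mean n X \<omega> + Y i \<omega> - sample_mean n Y \<omega>)"
  shows "((AE \<omega> in M. real_cond_exp M F (sample_mean n X) \<omega> = real_cond_exp M F (sample_mean n Y) \<omega>)
      \<longleftrightarrow> (\<forall>i\<in>{1..n}. distr M borel (X i) = distr M borel (Y i))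
        \<or> (\<forall>i\<in>{1..n}. eq_distr_plus_gaussian M (X i) (Y i))
        \<or> (\<forall>i\<in>{1..n}. eq_distr_plus_gaussian M (Y i) (X i)))
    \<and> ((AE \<omega> in M. real_cond_exp M F (sample_mean n X) \<omega> = real_cond_exp M F (sample_mean n Y) \<omega>)
      \<longrightarrow> (\<forall>i\<in>{1..n}. distr M borel (X i) = distr M borel (Y i))
        \<or> (\<forall>i\<in>{1..n}. has_gaussian_component M (X i))
        \<or> (\<forall>i\<in>{1..n}. has_gaussian_component M (Y i)))"
    (is "(?rel \<longleftrightarrow> ?same \<or> ?X_gauss \<or> ?Y_gauss) \<and> (?rel \<longrightarrow> ?same \<or> ?X_comp \<or> ?Y_comp)")
proof -
  interpret prob_space M by fact
  have one: "1 \<in> {1..n}" using \<open>n \<ge> 3\<close> by simp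
  \<comment> \<open>The first members represent the common laws of the two samples.\<close>
  define P where "P = distr M borel (X 1)"
  define Q where "Q = distr M borel (Y 1)"
  have rv: "X i \<in> borel_measurable M" "Y i \<in> borel_measurable M" if "i \<in> {1..n}" for i
  proof -
    have "case_sum X Y l \<in> borel_measurable M" if "l \<in> {1..n} <+> {1..n}" for l
      using assms(3) that by (auto simp: indep_vars_def)
    from this[OF InlI[OF that]] this[OF InrI[OF that]]
    show "X i \<in> borel_measurable M" "Y i \<in> borel_measurable M" by simp_all
  qed
  have P: "distr M borel (X i) = P" and Q: "distr M borel (Y i) = Q" if "i \<in> {1..n}" for i
    using assms(4,5) one that unfolding P_def Q_def by blast+
  have P_char: "char P u \<noteq> 0" and Q_char: "char Q u \<noteq> 0" for u
    using assms(10,11) one unfolding P_def Q_def by blast+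
  interpret P: real_distribution P
    unfolding P_def using rv[OF one] by (intro real_distribution_distr)
  interpret Q: real_distribution Q
    unfolding Q_def using rv[OF one] by (intro real_distribution_distr)
  have P_sq: "integrable P (\<lambda>x. x\<^sup>2)" and Q_sq: "integrable Q (\<lambda>x. x\<^sup>2)"
    unfolding P_def Q_def using rv[OF one] assms(6,7)[OF one] by (auto simp: integrable_distr_eq)
  have P_mean: "(\<integral>x. x \<partial>P) = 0" and Q_mean: "(\<integral>x. x \<partial>Q) = 0"
    unfolding P_def Q_def using rv[OF one] assms(8,9)[OF one] by (auto simp: integral_distr)
  define \<phi> where "\<phi> u = log_char_deriv P u - log_char_deriv Q u" for u
  have \<phi>_0: "\<phi> 0 = 0"
    using P_mean Q_mean by (simp add: \<phi>_def P.log_char_deriv_0 Q.log_char_deriv_0)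
  have \<phi>_cont: "continuous_on UNIV \<phi>"
    unfolding \<phi>_def[abs_def]
    by (intro continuous_on_diff P.continuous_on_log_char_deriv[OF P_sq P_char]
        Q.continuous_on_log_char_deriv[OF Q_sq Q_char])
  have "?rel \<longleftrightarrow> (\<forall>u. (\<Sum>k=1..n. u k) = 0 \<longrightarrow> (\<Sum>k=1..n. \<phi> (u k)) = 0)"
    unfolding F_def \<phi>_def
  proof (rule real_cond_exp_sample_means_eq_iff)
    fix i assume i: "i \<in> {1..n}"
    show "integrable M (X i)" "integrable M (Y i)"
      using rv[OF i] assms(6,7)[OF i] by (auto intro: square_integrable_imp_integrable)
  qed (use \<open>n \<ge> 3\<close> assms(3) P Q P_char Q_char in auto)
  also have "\<dots> \<longleftrightarrow> (\<exists>c. \<forall>u. \<phi> u = u *\<^sub>R c)"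
  proof
    assume zero: "\<forall>u. (\<Sum>k=1..n. u k) = 0 \<longrightarrow> (\<Sum>k=1..n. \<phi> (u k)) = 0"
    have "\<phi> (a + b) = \<phi> a + \<phi> b" for a b
      using zero by (intro additive_of_zero_sum[where \<phi> = \<phi> and n = n] \<open>n \<ge> 3\<close> \<phi>_0) blast
    from additive_continuous_imp_linear[OF this \<phi>_cont]
    show "\<exists>c. \<forall>u. \<phi> u = u *\<^sub>R c" by blast
  next
    assume "\<exists>c. \<forall>u. \<phi> u = u *\<^sub>R c"
    then obtain c where c: "\<And>u. \<phi> u = u *\<^sub>R c" by blast
    show "\<forall>u. (\<Sum>k=1..n. u k) = 0 \<longrightarrow> (\<Sum>k=1..n. \<phi> (u k)) = 0"
      by (simp add: c scaleR_sum_left[symmetric])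
  qed
  finally have rel: "?rel \<longleftrightarrow> (\<exists>c. \<forall>u. \<phi> u = u *\<^sub>R c)" .
  have iff: "?rel \<longleftrightarrow> ?same \<or> ?X_gauss \<or> ?Y_gauss"
  proof
    assume ?rel
    then obtain c where "\<And>u. log_char_deriv P u - log_char_deriv Q u = u *\<^sub>R c"
      unfolding rel \<phi>_def by blast
    from log_char_deriv_linear_imp_char_eq[OF P.real_distribution_axioms P_sq P_char
        Q.real_distribution_axioms Q_sq Q_char this]
    obtain s :: real where s: "\<And>u. char P u = char Q u * exp (- (s * u\<^sup>2 / 2))" by blast
    consider "s = 0" | "s > 0" | "s < 0" by linarith
    then show "?same \<or> ?X_gauss \<or> ?Y_gauss"
    proof cases
      case 1
      then have "char P = char Q" using s by auto
      then have "P = Q"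
        by (intro Levy_uniqueness P.real_distribution_axioms Q.real_distribution_axioms)
      then show ?thesis using P Q by simp
    next
      case 2
      have "eq_distr_plus_gaussian M (X i) (Y i)" if "i \<in> {1..n}" for i
        by (rule char_eq_imp_eq_distr_plus_gaussian[OF rv[OF that] 2]) (simp only: P[OF that] Q[OF that] s)
      then show ?thesis by blast
    next
      case 3
      then have "0 < - s" by simp
      \<comment> \<open>For negative \<open>s\<close> the relation is solved for
        \<open>char Q\<close>, and \<open>- s\<close> becomes the variance of the Gaussian added to
        \<open>X i\<close>.\<close>
      have QP: "char Q u = char P u * exp (- (- s * u\<^sup>2 / 2))" for u
        by (simp add: s mult.assoc of_real_mult[symmetric] exp_add[symmetric] del: of_real_mult)
      have "eq_distr_plus_gaussian M (Y i) (X i)" if "i \<in> {1..n}" for i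
        by (rule char_eq_imp_eq_distr_plus_gaussian[OF rv(2,1)[OF that] \<open>0 < - s\<close>])
          (simp only: P[OF that] Q[OF that] QP)
      then show ?thesis by blast
    qed
  next
    assume "?same \<or> ?X_gauss \<or> ?Y_gauss"
    then consider ?same | ?X_gauss | ?Y_gauss by blast
    then show ?rel
      unfolding rel
    proof cases
      case 1
      then have "P = Q" using one by (auto simp: P_def Q_def)
      then show "\<exists>c. \<forall>u. \<phi> u = u *\<^sub>R c"
        by (intro exI[of _ 0]) (simp add: \<phi>_def)
    next
      case 2
      then show "\<exists>c. \<forall>u. \<phi> u = u *\<^sub>R c"
        unfolding \<phi>_def using one
        by (intro eq_distr_plus_gaussian_imp_log_char_deriv_linear[OF P.real_distribution_axioms P_sq P_mean
            Q.real_distribution_axioms Q_sq Q_mean Q_char _ P[OF one] Q[OF one]]) blast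
    next
      case 3
      then have "\<exists>c. \<forall>u. log_char_deriv Q u - log_char_deriv P u = u *\<^sub>R c"
        using one
        by (intro eq_distr_plus_gaussian_imp_log_char_deriv_linear[OF Q.real_distribution_axioms Q_sq Q_mean
            P.real_distribution_axioms P_sq P_mean P_char _ Q[OF one] P[OF one]]) blast
      then obtain c where "\<And>u. log_char_deriv Q u - log_char_deriv P u = u *\<^sub>R c" by blast
      then show "\<exists>c. \<forall>u. \<phi> u = u *\<^sub>R c"
        \<comment> \<open>Exchanging the roles of the two laws negates the slope.\<close>
        unfolding \<phi>_def by (intro exI[of _ "- c"]) (metis minus_diff_eq scaleR_minus_right)
    qed
  qed
  then show ?thesis
    by (blast dest: eq_distr_plus_gaussian_imp_has_gaussian_component)
qed

end
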